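(* Let $p\ge1$ be an integer, $\alpha_1,\dots,\alpha_p>0$, $\beta_1,\dots,\beta_{p+1}>0$, $B_1\ge0$, and suppose $\alpha_i\ge\beta_{i+1}$ for $i=1,\dots,p$. Let $$\Psi(z)=\sum_{k=0}^\infty\frac{\prod_{i=1}^p\Gamma(\alpha_i+k)}{\Gamma(\beta_1+kB_1)\prod_{i=2}^{p+1}\Gamma(\beta_i+k)}\frac{z^k}{k!},\qquad \Psi^*(z)=\frac{\prod_{i=1}^{p+1}\Gamma(\beta_i)}{\prod_{i=1}^p\Gamma(\alpha_i)}\,\Psi(z),$$ and $$\Psi_+(z)=\sum_{k=0}^\infty\frac{\prod_{i=1}^p\Gamma(\alpha_i+1+k)}{\Gamma(\beta_1+B_1+kB_1)\prod_{i=2}^{p+1}\Gamma(\beta_i+1+k)}\frac{z^k}{k!}.$$ Then the function $z\mapsto\Psi^*(z)$ is log-concave on $(0,\infty)$. Furthermore, the following inequalities hold: $$\Psi^*(z_1)\,\Psi^*(z_2)\le\Big[\Psi^*\Big(\frac{z_1+z_2}{2}\Big)\Big]^2,\qquad z_1,z_2>0,$$ $$\Psi^*(z)\le\exp\left(\Big(\prod_{i=1}^p\frac{\alpha_i}{\beta_{i+1}}\Big)\frac{\Gamma(\beta_1)}{\Gamma(\beta_1+B_1)}\,z\right),\qquad z>0,$$ $$\Psi_+(z)\le\Big(\prod_{i=1}^p\frac{\alpha_i}{\beta_{i+1}}\Big)\frac{\Gamma(\beta_1)}{\Gamma(\beta_1+B_1)}\,\Psi(z),\qquad z>0.$$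
   Context: In Fox-Wright notation, with ${}_p\Psi_q\Big[\begin{matrix}(\alpha_1,A_1),\dots,(\alpha_p,A_p)\\ (\beta_1,B_1),\dots,(\beta_q,B_q)\end{matrix}\Big|z\Big]=\sum_{k=0}^\infty\frac{\prod_{l=1}^p\Gamma(\alpha_l+kA_l)}{\prod_{l=1}^q\Gamma(\beta_l+kB_l)}\frac{z^k}{k!}$, the function $\Psi$ is ${}_p\Psi_{p+1}$ with upper pairs $(\alpha_i,1)$, $1\le i\le p$, and lower pairs $(\beta_1,B_1),(\beta_2,1),\dots,(\beta_{p+1},1)$; $\Psi^*$ is the normalized Fox-Wright function ${}_p\Psi^*_{p+1}$ (so $\Psi^*(0)=1$); and $\Psi_+$ is ${}_p\Psi_{p+1}$ with upper pairs $(\alpha_i+1,1)$ and lower pairs $(\beta_1+B_1,B_1),(\beta_2+1,1),\dots,(\beta_{p+1}+1,1)$. A positive function $f$ is log-concave if $\log f$ is concave. *)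

theory Defs
  imports "HOL-Analysis.Analysis"
begin

(* Parameters are indexed from 1: the upper pairs are (a l, A l) for 1 <= l <= p,
   the lower pairs are (b l, B l) for 1 <= l <= q. Values outside these ranges are irrelevant. *)

definition fox_wright ::
  "nat \<Rightarrow> (nat \<Rightarrow> real) \<Rightarrow> (nat \<Rightarrow> real) \<Rightarrow> nat \<Rightarrow> (nat \<Rightarrow> real) \<Rightarrow> (nat \<Rightarrow> real) \<Rightarrow> real \<Rightarrow> real"
  where
  "fox_wright p a A q b B z =
     (\<Sum>k. (\<Prod>l=1..p. Gamma (a l + real k * A l)) / (\<Prod>l=1..q. Gamma (b l + real k * B l))
            * (z ^ k / fact k))"

definition fox_wright_normalized ::
  "nat \<Rightarrow> (nat \<Rightarrow> real) \<Rightarrow> (nat \<Rightarrow> real) \<Rightarrow> nat \<Rightarrow> (nat \<Rightarrow> real) \<Rightarrow> (nat \<Rightarrow> real) \<Rightarrow> real \<Rightarrow> real"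
  where
  "fox_wright_normalized p a A q b B z =
     (\<Prod>l=1..q. Gamma (b l)) / (\<Prod>l=1..p. Gamma (a l)) * fox_wright p a A q b B z"

(* The step sequence (B1, 1, 1, ...) of the lower pairs. *)
definition lower_step :: "real \<Rightarrow> nat \<Rightarrow> real" where
  "lower_step B1 l = (if l = 1 then B1 else 1)"

definition Psi :: "nat \<Rightarrow> (nat \<Rightarrow> real) \<Rightarrow> (nat \<Rightarrow> real) \<Rightarrow> real \<Rightarrow> real \<Rightarrow> real" where
  "Psi p \<alpha> \<beta> B1 = fox_wright p \<alpha> (\<lambda>_. 1) (p + 1) \<beta> (lower_step B1)"

definition Psi_star :: "nat \<Rightarrow> (nat \<Rightarrow> real) \<Rightarrow> (nat \<Rightarrow> real) \<Rightarrow> real \<Rightarrow> real \<Rightarrow> real" where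
  "Psi_star p \<alpha> \<beta> B1 = fox_wright_normalized p \<alpha> (\<lambda>_. 1) (p + 1) \<beta> (lower_step B1)"

(* Every parameter is shifted by its own step. *)
definition Psi_plus :: "nat \<Rightarrow> (nat \<Rightarrow> real) \<Rightarrow> (nat \<Rightarrow> real) \<Rightarrow> real \<Rightarrow> real \<Rightarrow> real" where
  "Psi_plus p \<alpha> \<beta> B1 =
     fox_wright p (\<lambda>l. \<alpha> l + 1) (\<lambda>_. 1) (p + 1) (\<lambda>l. \<beta> l + lower_step B1 l) (lower_step B1)"

definition log_concave_on :: "'a::real_vector set \<Rightarrow> ('a \<Rightarrow> real) \<Rightarrow> bool" where
  "log_concave_on S f \<longleftrightarrow> (\<forall>x\<in>S. 0 < f x) \<and> concave_on S (\<lambda>x. ln (f x))"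

lemma Psi_series:
  "Psi p \<alpha> \<beta> B1 z =
     (\<Sum>k. (\<Prod>i=1..p. Gamma (\<alpha> i + real k)) /
            (Gamma (\<beta> 1 + real k * B1) * (\<Prod>i=2..p+1. Gamma (\<beta> i + real k)))
            * (z ^ k / fact k))"
proof -
  have "(\<Prod>l=1..p+1. Gamma (\<beta> l + real k * lower_step B1 l)) =
      Gamma (\<beta> 1 + real k * B1) * (\<Prod>i=2..p+1. Gamma (\<beta> i + real k))" for k
    by (subst prod.atLeast_Suc_atMost)
       (auto simp: lower_step_def numeral_2_eq_2 intro!: prod.cong)
  then show ?thesis
    unfolding Psi_def fox_wright_def by simp
qed

lemma Psi_star_eq:
  "Psi_star p \<alpha> \<beta> B1 z =
     (\<Prod>i=1..p+1. Gamma (\<beta> i)) / (\<Prod>i=1..p. Gamma (\<alpha> i)) * Psi p \<alpha> \<beta> B1 z"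
  by (simp add: Psi_star_def fox_wright_normalized_def Psi_def)

lemma Psi_plus_series:
  "Psi_plus p \<alpha> \<beta> B1 z =
     (\<Sum>k. (\<Prod>i=1..p. Gamma (\<alpha> i + 1 + real k)) /
            (Gamma (\<beta> 1 + B1 + real k * B1) * (\<Prod>i=2..p+1. Gamma (\<beta> i + 1 + real k)))
            * (z ^ k / fact k))"
proof -
  have "(\<Prod>l=1..p+1. Gamma (\<beta> l + lower_step B1 l + real k * lower_step B1 l)) =
      Gamma (\<beta> 1 + B1 + real k * B1) * (\<Prod>i=2..p+1. Gamma (\<beta> i + 1 + real k))" for k
    by (subst prod.atLeast_Suc_atMost)
       (auto simp: lower_step_def numeral_2_eq_2 intro!: prod.cong)
  then show ?thesis
    unfolding Psi_plus_def fox_wright_def by simp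
qed

end

theory Submission
  imports Defs
begin

text \<open>
  Write \<open>\<Psi>(z) = \<Sum>k. a k * z^k / k!\<close> with \<open>a k > 0\<close>. Everything follows from one property of the
  coefficients: the sequence \<open>a\<close> is log-concave, i.e.\ the quotients \<open>a (k+1) / a k\<close> decrease.

  These quotients are
  \<open>(\<Prod>i. (\<alpha> i + k) / (\<beta> (i+1) + k)) * \<Gamma>(\<beta> 1 + k * B1) / \<Gamma>(\<beta> 1 + (k+1) * B1)\<close>.
  Each rational factor decreases in \<open>k\<close> because \<open>\<alpha> i \<ge> \<beta> (i+1)\<close>, and the quotient of
  Gamma values decreases because Gamma is log-convex (\<open>decseq_Gamma_quotient\<close>).

  Differentiating an exponential generating function shifts its coefficients, so \<open>\<Psi>' = \<Psi>\<^sub>+\<close>, and the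
  logarithmic derivative \<open>\<Psi>\<^sub>+ / \<Psi>\<close> is a quotient of two power series whose coefficient quotients
  decrease. By the monotonicity rule of Biernacki and Krzyz (\<open>egf_quotient_antimono\<close>) it is itself
  decreasing on the positive axis, which is log-concavity of \<open>\<Psi>\<close>. The midpoint inequality is a
  special case of concavity. The two upper bounds compare coefficients: with \<open>c = a 1 / a 0\<close> one has
  \<open>a (k+1) \<le> c * a k\<close>, hence \<open>\<Psi>\<^sub>+ \<le> c * \<Psi>\<close>, and by iteration \<open>a k \<le> a 0 * c^k\<close>,
  hence \<open>\<Psi>(z) \<le> a 0 * exp (c * z)\<close>; the latter also makes the series converge everywhere.
  Finally \<open>\<Psi>\<^sup>* = \<Psi> / a 0\<close>, and \<open>c\<close> is the quotient above at \<open>k = 0\<close>, the constant of the theorem.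
\<close>

section \<open>Quotients of exponential generating functions\<close>

definition egf :: "(nat \<Rightarrow> real) \<Rightarrow> real \<Rightarrow> real" where
  "egf a z = (\<Sum>k. a k * (z ^ k / fact k))"

text \<open>
  For finite sums the difference of the two sides is a double sum over \<open>(m, n)\<close>; adding to it the same
  sum with \<open>m\<close> and \<open>n\<close> exchanged makes every term a product of two factors of equal sign.
  Working with truncations first means that no infinite double series has to be rearranged.
\<close>

lemma power_sum_cross_le:
  fixes a b w :: "nat \<Rightarrow> real"
  assumes w: "\<And>k. 0 \<le> w k"
    and ab: "\<And>m n. m \<le> n \<Longrightarrow> b n * a m \<le> b m * a n"
    and xy: "0 \<le> x" "x \<le> y"
  shows "(\<Sum>k<N. b k * (y ^ k * w k)) * (\<Sum>k<N. a k * (x ^ k * w k))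
       \<le> (\<Sum>k<N. b k * (x ^ k * w k)) * (\<Sum>k<N. a k * (y ^ k * w k))"
proof -
  define T where "T m n = w m * w n * (b m * a n * (x ^ m * y ^ n - y ^ m * x ^ n))" for m n
  have powers: "y ^ m * x ^ n \<le> x ^ m * y ^ n" if "m \<le> n" for m n
  proof -
    have "(x * y) ^ m * x ^ (n - m) \<le> (x * y) ^ m * y ^ (n - m)"
      using xy by (intro mult_left_mono power_mono) auto
    moreover have "z ^ n = z ^ m * z ^ (n - m)" for z :: real
      using that by (simp flip: power_add)
    ultimately show ?thesis by (simp add: power_mult_distrib mult_ac)
  qed
  have sym_eq: "T m n + T n m
      = w m * w n * ((b m * a n - b n * a m) * (x ^ m * y ^ n - y ^ m * x ^ n))" for m n
    unfolding T_def by (simp add: algebra_simps)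
  have le: "0 \<le> T m n + T n m" if "m \<le> n" for m n
    unfolding sym_eq using that w ab powers by (intro mult_nonneg_nonneg) auto
  have nonneg: "0 \<le> T m n + T n m" for m n
    using le[of m n] le[of n m] by (cases "m \<le> n") auto
  have "(\<Sum>k<N. b k * (x ^ k * w k)) * (\<Sum>k<N. a k * (y ^ k * w k))
      - (\<Sum>k<N. b k * (y ^ k * w k)) * (\<Sum>k<N. a k * (x ^ k * w k)) = (\<Sum>m<N. \<Sum>n<N. T m n)"
    unfolding T_def sum_product sum_subtractf[symmetric]
    by (intro sum.cong refl) (simp add: algebra_simps)
  moreover have "2 * (\<Sum>m<N. \<Sum>n<N. T m n) = (\<Sum>m<N. \<Sum>n<N. T m n + T n m)"
    using sum.swap[of T "{..<N}" "{..<N}"] by (simp add: sum.distrib)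
  moreover have "0 \<le> (\<Sum>m<N. \<Sum>n<N. T m n + T n m)"
    using nonneg by (intro sum_nonneg)
  ultimately show ?thesis by linarith
qed

text \<open>
  The hypothesis is that \<open>b k / a k\<close> decreases, stated without division. The truncated series satisfy
  the cross-multiplied inequality, which passes to the limit.
\<close>

lemma egf_quotient_antimono:
  assumes ab: "\<And>m n. m \<le> n \<Longrightarrow> b n * a m \<le> b m * a n"
    and a: "\<And>z. summable (\<lambda>k. a k * (z ^ k / fact k))"
    and b: "\<And>z. summable (\<lambda>k. b k * (z ^ k / fact k))"
    and pos: "0 < egf a x" "0 < egf a y" and xy: "0 \<le> x" "x \<le> y"
  shows "egf b y / egf a y \<le> egf b x / egf a x"
proof -
  have lim: "(\<lambda>N. \<Sum>k<N. c k * (z ^ k / fact k)) \<longlonglongrightarrow> egf c z"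
    if "summable (\<lambda>k. c k * (z ^ k / fact k))" for c z
    unfolding egf_def using that by (rule summable_LIMSEQ)
  have "egf b y * egf a x \<le> egf b x * egf a y"
  proof (rule LIMSEQ_le)
    show "\<exists>N0. \<forall>N\<ge>N0.
       (\<Sum>k<N. b k * (y ^ k / fact k)) * (\<Sum>k<N. a k * (x ^ k / fact k))
       \<le> (\<Sum>k<N. b k * (x ^ k / fact k)) * (\<Sum>k<N. a k * (y ^ k / fact k))"
      using power_sum_cross_le[of "\<lambda>k. 1 / fact k" b a x y] ab xy by simp
  qed (intro tendsto_mult lim a b)+
  then show ?thesis
    using pos by (simp add: field_simps)
qed

section \<open>Log-concave coefficient sequences\<close>

locale log_concave_sequence =
  fixes a :: "nat \<Rightarrow> real"
  assumes pos: "0 < a k"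
    and quotient_decseq: "decseq (\<lambda>k. a (Suc k) / a k)"
begin

definition growth :: real where
  "growth = a 1 / a 0"

lemma growth_nonneg: "0 \<le> growth"
  using pos[of 0] pos[of 1] by (simp add: growth_def)

lemma shift_le: "a (Suc k) \<le> growth * a k"
  using decseqD[OF quotient_decseq, of 0 k] pos[of k]
  by (simp add: growth_def field_simps)

text \<open>
  Besides giving the exponential bound, this dominates the generating function by an exponential
  series, so that it converges on the whole line.
\<close>

lemma geometric_bound: "a k \<le> a 0 * growth ^ k"
proof (induction k)
  case (Suc k)
  have "a (Suc k) \<le> growth * a k" by (rule shift_le)
  also have "\<dots> \<le> growth * (a 0 * growth ^ k)"
    using Suc growth_nonneg by (intro mult_left_mono) auto
  finally show ?case by (simp add: mult_ac)
qed simp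

lemma summable_egf: "summable (\<lambda>k. a k * (z ^ k / fact k))"
proof (rule summable_comparison_test')
  show "summable (\<lambda>k. a 0 * ((growth * \<bar>z\<bar>) ^ k / fact k))"
    using summable_exp[of "growth * \<bar>z\<bar>"]
    by (intro summable_mult) (simp add: field_simps)
  show "norm (a k * (z ^ k / fact k)) \<le> a 0 * ((growth * \<bar>z\<bar>) ^ k / fact k)" for k
  proof -
    have "a k * (\<bar>z\<bar> ^ k / fact k) \<le> a 0 * growth ^ k * (\<bar>z\<bar> ^ k / fact k)"
      by (intro mult_right_mono geometric_bound) auto
    then show ?thesis
      using pos[of k] by (simp add: abs_mult power_abs power_mult_distrib)
  qed
qed

lemma summable_egf_shift: "summable (\<lambda>k. a (Suc k) * (z ^ k / fact k))"
proof (rule summable_comparison_test')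
  show "summable (\<lambda>k. growth * (a k * (\<bar>z\<bar> ^ k / fact k)))"
    by (intro summable_mult summable_egf)
  show "norm (a (Suc k) * (z ^ k / fact k)) \<le> growth * (a k * (\<bar>z\<bar> ^ k / fact k))" for k
    using mult_right_mono[OF shift_le[of k], of "\<bar>z\<bar> ^ k / fact k"] pos[of "Suc k"]
    by (simp add: abs_mult power_abs)
qed

lemma egf_pos:
  assumes "0 < z"
  shows "0 < egf a z"
  unfolding egf_def using assms by (intro suminf_pos summable_egf mult_pos_pos pos) auto

lemma egf_shift_le:
  assumes "0 < z"
  shows "egf (\<lambda>k. a (Suc k)) z \<le> growth * egf a z"
proof -
  have "egf (\<lambda>k. a (Suc k)) z \<le> (\<Sum>k. growth * (a k * (z ^ k / fact k)))"
    unfolding egf_def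
  proof (intro suminf_le summable_egf_shift summable_mult summable_egf)
    show "a (Suc k) * (z ^ k / fact k) \<le> growth * (a k * (z ^ k / fact k))" for k
      using mult_right_mono[OF shift_le[of k], of "z ^ k / fact k"] assms by simp
  qed
  then show ?thesis
    unfolding egf_def by (simp only: suminf_mult[OF summable_egf])
qed

lemma egf_le_exp:
  assumes "0 < z"
  shows "egf a z \<le> a 0 * exp (growth * z)"
proof -
  have exp_sums: "(\<lambda>k. a 0 * ((growth * z) ^ k / fact k)) sums (a 0 * exp (growth * z))"
    using exp_converges[of "growth * z"] by (intro sums_mult) (simp add: field_simps)
  have "a k * (z ^ k / fact k) \<le> a 0 * ((growth * z) ^ k / fact k)" for k
    using mult_right_mono[OF geometric_bound[of k], of "z ^ k / fact k"] assms
    by (simp add: power_mult_distrib)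
  then show ?thesis
    unfolding egf_def using sums_le[OF _ summable_sums[OF summable_egf] exp_sums] by blast
qed

lemma egf_has_derivative: "(egf a has_real_derivative egf (\<lambda>k. a (Suc k)) z) (at z)"
proof -
  have "((\<lambda>z. \<Sum>k. a k / fact k * z ^ k) has_real_derivative
      (\<Sum>k. diffs (\<lambda>k. a k / fact k) k * z ^ k)) (at z)"
    using summable_egf by (intro termdiffs_strong_converges_everywhere) simp
  moreover have "diffs (\<lambda>k. a k / fact k) k = a (Suc k) / fact k" for k
    by (simp add: diffs_def del: of_nat_Suc)
  ultimately show ?thesis
    by (simp add: egf_def[abs_def])
qed

text \<open>
  The coefficient sequences of the derivative and of the function itself have quotient
  \<open>a (k+1) / a k\<close>, so the logarithmic derivative falls under \<open>egf_quotient_antimono\<close>.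
\<close>

lemma log_concave_egf: "log_concave_on {0<..} (egf a)"
  unfolding log_concave_on_def concave_on_def
proof (intro conjI ballI)
  show "0 < egf a z" if "z \<in> {0<..}" for z
    using that egf_pos by simp
  show "convex_on {0<..} (\<lambda>z. - ln (egf a z))"
  proof (rule convex_on_realI[where f' = "\<lambda>z. - (egf (\<lambda>k. a (Suc k)) z / egf a z)"])
    show "((\<lambda>z. - ln (egf a z)) has_real_derivative
        - (egf (\<lambda>k. a (Suc k)) z / egf a z)) (at z)" if "z \<in> {0<..}" for z
      using that egf_pos[of z]
      by (auto intro!: derivative_eq_intros egf_has_derivative simp: field_simps)
    show "- (egf (\<lambda>k. a (Suc k)) x / egf a x) \<le> - (egf (\<lambda>k. a (Suc k)) y / egf a y)"
      if "x \<in> {0<..}" "y \<in> {0<..}" "x \<le> y" for x y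
    proof -
      have "a (Suc n) * a m \<le> a (Suc m) * a n" if "m \<le> n" for m n
        using decseqD[OF quotient_decseq that] pos[of m] pos[of n] by (simp add: field_simps)
      then have "egf (\<lambda>k. a (Suc k)) y / egf a y \<le> egf (\<lambda>k. a (Suc k)) x / egf a x"
        using that by (intro egf_quotient_antimono summable_egf summable_egf_shift egf_pos) auto
      then show ?thesis by simp
    qed
  qed auto
qed

end

section \<open>Log-concave functions\<close>

lemma log_concave_on_cmult:
  assumes f: "log_concave_on S f" and c: "0 < c"
  shows "log_concave_on S (\<lambda>x. c * f x)"
proof -
  have "concave_on S (\<lambda>x. ln c + ln (f x))"
    using f unfolding log_concave_on_def
    by (intro concave_on_add) (auto simp: concave_on_const dest: concave_on_imp_convex)
  moreover have "ln (c * f x) = ln c + ln (f x)" if "x \<in> S" for x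
    using f c that by (auto simp: log_concave_on_def intro!: ln_mult_pos)
  ultimately have "concave_on S (\<lambda>x. ln (c * f x))"
    unfolding concave_on_iff by (auto simp: convex_def)
  then show ?thesis
    using f c by (simp add: log_concave_on_def)
qed

lemma log_concave_on_midpoint:
  fixes f :: "real \<Rightarrow> real"
  assumes f: "log_concave_on S f" and xy: "x \<in> S" "y \<in> S"
  shows "f x * f y \<le> (f ((x + y) / 2))\<^sup>2"
proof -
  have conc: "concave_on S (\<lambda>x. ln (f x))" and fpos: "\<And>z. z \<in> S \<Longrightarrow> 0 < f z"
    using f by (auto simp: log_concave_on_def)
  have mid: "(x + y) / 2 \<in> S"
    using convexD[OF concave_on_imp_convex[OF conc] xy, of "1/2" "1/2"] by (simp add: field_simps)
  have "ln (f x) + ln (f y) \<le> 2 * ln (f ((x + y) / 2))"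
    using concave_onD[OF conc, of "1/2" x y] xy by (simp add: field_simps)
  then have "ln (f x * f y) \<le> ln ((f ((x + y) / 2))\<^sup>2)"
    using fpos[OF xy(1)] fpos[OF xy(2)] fpos[OF mid] by (simp add: ln_mult ln_realpow)
  then show ?thesis
    using fpos[OF xy(1)] fpos[OF xy(2)] fpos[OF mid] by simp
qed

section \<open>The Fox-Wright coefficients\<close>

text \<open>The quotient equals \<open>1 + (\<alpha> - \<beta>) / (\<beta> + k)\<close>.\<close>

lemma decseq_linear_quotient:
  fixes \<alpha> \<beta> :: real
  assumes "0 < \<beta>" "\<beta> \<le> \<alpha>"
  shows "decseq (\<lambda>k. (\<alpha> + real k) / (\<beta> + real k))"
proof (rule decseq_SucI)
  fix k
  have "0 < \<beta> + real k" "0 < \<beta> + real (Suc k)" using assms by auto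
  then show "(\<alpha> + real (Suc k)) / (\<beta> + real (Suc k)) \<le> (\<alpha> + real k) / (\<beta> + real k)"
    using assms by (simp add: divide_simps) (simp add: algebra_simps)
qed

text \<open>
  Log-convexity of Gamma at the midpoint of \<open>\<beta> + k * B\<close> and \<open>\<beta> + (k+2) * B\<close> is exactly the
  comparison of two consecutive quotients.
\<close>

lemma decseq_Gamma_quotient:
  fixes \<beta> B :: real
  assumes "0 < \<beta>" "0 \<le> B"
  shows "decseq (\<lambda>k. Gamma (\<beta> + real k * B) / Gamma (\<beta> + real (Suc k) * B))"
proof (rule decseq_SucI)
  fix k
  define x where "x = \<beta> + real k * B"
  have x: "0 < x" and steps: "\<beta> + real (Suc k) * B = x + B" "\<beta> + real (Suc (Suc k)) * B = x + 2 * B"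
    using assms by (auto simp: x_def algebra_simps intro: add_pos_nonneg)
  have G: "0 < Gamma x" "0 < Gamma (x + B)" "0 < Gamma (x + 2 * B)"
    using x assms by (auto intro!: Gamma_real_pos)
  have "2 * ln (Gamma (x + B)) \<le> ln (Gamma x) + ln (Gamma (x + 2 * B))"
  proof -
    have "(1 - 1/2) *\<^sub>R x + (1/2) *\<^sub>R (x + 2 * B) = x + B"
      by (simp add: algebra_simps)
    then show ?thesis
      using convex_onD[OF log_convex_Gamma_real, of "1/2" x "x + 2 * B"] x assms by simp
  qed
  then have "ln ((Gamma (x + B))\<^sup>2) \<le> ln (Gamma x * Gamma (x + 2 * B))"
    using G by (simp add: ln_mult ln_realpow)
  then have "(Gamma (x + B))\<^sup>2 \<le> Gamma x * Gamma (x + 2 * B)"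
    using G by simp
  then show "Gamma (\<beta> + real (Suc k) * B) / Gamma (\<beta> + real (Suc (Suc k)) * B)
      \<le> Gamma (\<beta> + real k * B) / Gamma (\<beta> + real (Suc k) * B)"
    unfolding steps x_def[symmetric] using G by (simp add: field_simps power2_eq_square)
qed

definition psi_coeff :: "nat \<Rightarrow> (nat \<Rightarrow> real) \<Rightarrow> (nat \<Rightarrow> real) \<Rightarrow> real \<Rightarrow> nat \<Rightarrow> real" where
  "psi_coeff p \<alpha> \<beta> B1 k = (\<Prod>i=1..p. Gamma (\<alpha> i + real k)) /
     (Gamma (\<beta> 1 + real k * B1) * (\<Prod>i=2..p+1. Gamma (\<beta> i + real k)))"

lemma Psi_eq_egf: "Psi p \<alpha> \<beta> B1 = egf (psi_coeff p \<alpha> \<beta> B1)"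
  by (simp add: fun_eq_iff Psi_series egf_def psi_coeff_def)

lemma Psi_plus_eq_egf: "Psi_plus p \<alpha> \<beta> B1 = egf (\<lambda>k. psi_coeff p \<alpha> \<beta> B1 (Suc k))"
  by (simp add: fun_eq_iff Psi_plus_series egf_def psi_coeff_def algebra_simps)

lemma Psi_star_eq_Psi:
  "Psi_star p \<alpha> \<beta> B1 z = 1 / psi_coeff p \<alpha> \<beta> B1 0 * Psi p \<alpha> \<beta> B1 z"
proof -
  have "(\<Prod>i=1..p+1. Gamma (\<beta> i)) = Gamma (\<beta> 1) * (\<Prod>i=2..p+1. Gamma (\<beta> i))"
    by (subst prod.atLeast_Suc_atMost) (auto simp: numeral_2_eq_2)
  then show ?thesis
    by (simp add: Psi_star_eq psi_coeff_def)
qed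

context
  fixes p :: nat and \<alpha> \<beta> :: "nat \<Rightarrow> real" and B1 :: real
  assumes \<alpha>: "\<And>i. i \<in> {1..p} \<Longrightarrow> \<alpha> i > 0"
    and \<beta>: "\<And>i. i \<in> {1..p+1} \<Longrightarrow> \<beta> i > 0"
    and B1: "B1 \<ge> 0"
begin

lemma psi_coeff_pos: "0 < psi_coeff p \<alpha> \<beta> B1 k"
  unfolding psi_coeff_def using B1
  by (intro divide_pos_pos mult_pos_pos prod_pos Gamma_real_pos ballI add_pos_nonneg \<alpha> \<beta>) auto

text \<open>
  The functional equation of Gamma turns each unit-step factor into a rational one; only the
  factor with step \<open>B1\<close> remains a quotient of Gamma values. Lower parameters are reindexed so that
  \<open>\<alpha> i\<close> is paired with \<open>\<beta> (i+1)\<close>.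
\<close>

lemma psi_coeff_quotient:
  "psi_coeff p \<alpha> \<beta> B1 (Suc k) / psi_coeff p \<alpha> \<beta> B1 k
     = (\<Prod>i=1..p. (\<alpha> i + real k) / (\<beta> (i + 1) + real k))
       * (Gamma (\<beta> 1 + real k * B1) / Gamma (\<beta> 1 + real (Suc k) * B1))"
proof -
  have step: "(\<Prod>i\<in>I. Gamma (c i + real (Suc k)))
      = (\<Prod>i\<in>I. c i + real k) * (\<Prod>i\<in>I. Gamma (c i + real k))"
    if "\<And>i. i \<in> I \<Longrightarrow> 0 < c i" for I and c :: "nat \<Rightarrow> real"
    unfolding prod.distrib[symmetric]
  proof (intro prod.cong refl)
    fix i assume "i \<in> I"
    then have "0 < c i + real k"
      using that[of i] by linarith
    then have "c i + real k \<notin> \<int>\<^sub>\<le>\<^sub>0"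
      using nonpos_Ints_nonpos[of "c i + real k"] by linarith
    then show "Gamma (c i + real (Suc k)) = (c i + real k) * Gamma (c i + real k)"
      using Gamma_plus1[of "c i + real k"] by (simp add: add_ac)
  qed
  have shift: "(\<Prod>i=2..p+1. \<beta> i + real k) = (\<Prod>i=1..p. \<beta> (i + 1) + real k)"
    using prod.shift_bounds_cl_nat_ivl[of "\<lambda>i. \<beta> i + real k" 1 1 p] by (simp add: numeral_2_eq_2)
  have upper: "(\<Prod>i=1..p. Gamma (\<alpha> i + real (Suc k)))
      = (\<Prod>i=1..p. \<alpha> i + real k) * (\<Prod>i=1..p. Gamma (\<alpha> i + real k))"
    using \<alpha> by (intro step)
  have lower: "(\<Prod>i=2..p+1. Gamma (\<beta> i + real (Suc k)))
      = (\<Prod>i=1..p. \<beta> (i + 1) + real k) * (\<Prod>i=2..p+1. Gamma (\<beta> i + real k))"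
    unfolding shift[symmetric] using \<beta> by (intro step) auto
  \<comment> \<open>Positivity of the Gamma products is what allows them to be cancelled.\<close>
  have "0 < (\<Prod>i=1..p. Gamma (\<alpha> i + real k))" "0 < (\<Prod>i=2..p+1. Gamma (\<beta> i + real k))"
    by (intro prod_pos Gamma_real_pos ballI add_pos_nonneg \<alpha> \<beta>; simp)+
  moreover have "A * X / (G' * (D * Y)) / (X / (G * Y)) = A / D * (G / G')"
    if "0 < X" "0 < Y" for A D G G' X Y :: real
    using that by simp
  ultimately show ?thesis
    unfolding psi_coeff_def upper lower prod_dividef by blast
qed

lemma log_concave_psi_coeff:
  assumes \<alpha>\<beta>: "\<And>i. i \<in> {1..p} \<Longrightarrow> \<alpha> i \<ge> \<beta> (i + 1)"
  shows "log_concave_sequence (psi_coeff p \<alpha> \<beta> B1)"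
proof
  show "0 < psi_coeff p \<alpha> \<beta> B1 k" for k
    by (rule psi_coeff_pos)
  show "decseq (\<lambda>k. psi_coeff p \<alpha> \<beta> B1 (Suc k) / psi_coeff p \<alpha> \<beta> B1 k)"
    unfolding psi_coeff_quotient
  proof (rule decseq_SucI, rule mult_mono)
    fix k
    have nonneg: "0 \<le> (\<alpha> i + real j) / (\<beta> (i + 1) + real j)" if "i \<in> {1..p}" for i j
      using \<alpha>[OF that] \<beta>[of "i + 1"] that by (intro divide_nonneg_nonneg) auto
    have "(\<alpha> i + real (Suc k)) / (\<beta> (i + 1) + real (Suc k)) \<le> (\<alpha> i + real k) / (\<beta> (i + 1) + real k)"
      if "i \<in> {1..p}" for i
      using decseq_linear_quotient[OF \<beta>[of "i + 1"] \<alpha>\<beta>[OF that]] that by (auto dest: decseq_SucD)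
    then show "(\<Prod>i=1..p. (\<alpha> i + real (Suc k)) / (\<beta> (i + 1) + real (Suc k)))
        \<le> (\<Prod>i=1..p. (\<alpha> i + real k) / (\<beta> (i + 1) + real k))"
      using nonneg by (intro prod_mono) blast
    show "Gamma (\<beta> 1 + real (Suc k) * B1) / Gamma (\<beta> 1 + real (Suc (Suc k)) * B1)
        \<le> Gamma (\<beta> 1 + real k * B1) / Gamma (\<beta> 1 + real (Suc k) * B1)"
      using decseq_Gamma_quotient[OF \<beta>[of 1] B1] by (auto dest: decseq_SucD)
    show "0 \<le> (\<Prod>i=1..p. (\<alpha> i + real k) / (\<beta> (i + 1) + real k))"
      using nonneg by (intro prod_nonneg) blast
    show "0 \<le> Gamma (\<beta> 1 + real (Suc k) * B1) / Gamma (\<beta> 1 + real (Suc (Suc k)) * B1)"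
      using B1 by (intro divide_nonneg_nonneg Gamma_real_nonneg add_pos_nonneg \<beta>) auto
  qed
qed

end

theorem theorem8:
  fixes p :: nat and \<alpha> \<beta> :: "nat \<Rightarrow> real" and B1 :: real
  assumes "p \<ge> 1"
    and "\<And>i. i \<in> {1..p} \<Longrightarrow> \<alpha> i > 0"
    and "\<And>i. i \<in> {1..p+1} \<Longrightarrow> \<beta> i > 0"
    and "B1 \<ge> 0"
    and "\<And>i. i \<in> {1..p} \<Longrightarrow> \<alpha> i \<ge> \<beta> (i + 1)"
  shows "log_concave_on {0<..} (Psi_star p \<alpha> \<beta> B1)
    \<and> (\<forall>z1>0. \<forall>z2>0.
          Psi_star p \<alpha> \<beta> B1 z1 * Psi_star p \<alpha> \<beta> B1 z2
            \<le> (Psi_star p \<alpha> \<beta> B1 ((z1 + z2) / 2))\<^sup>2)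
    \<and> (\<forall>z>0. Psi_star p \<alpha> \<beta> B1 z
            \<le> exp ((\<Prod>i=1..p. \<alpha> i / \<beta> (i + 1)) * (Gamma (\<beta> 1) / Gamma (\<beta> 1 + B1)) * z))
    \<and> (\<forall>z>0. Psi_plus p \<alpha> \<beta> B1 z
            \<le> (\<Prod>i=1..p. \<alpha> i / \<beta> (i + 1)) * (Gamma (\<beta> 1) / Gamma (\<beta> 1 + B1)) * Psi p \<alpha> \<beta> B1 z)"
proof -
  interpret log_concave_sequence "psi_coeff p \<alpha> \<beta> B1"
    using assms by (intro log_concave_psi_coeff)
  have growth_eq: "growth
      = (\<Prod>i=1..p. \<alpha> i / \<beta> (i + 1)) * (Gamma (\<beta> 1) / Gamma (\<beta> 1 + B1))"
    using psi_coeff_quotient[of p \<alpha> \<beta> B1 0] assms by (simp add: growth_def)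
  have star_eq: "Psi_star p \<alpha> \<beta> B1
      = (\<lambda>z. 1 / psi_coeff p \<alpha> \<beta> B1 0 * egf (psi_coeff p \<alpha> \<beta> B1) z)"
    by (simp add: fun_eq_iff Psi_star_eq_Psi Psi_eq_egf)
  have conc: "log_concave_on {0<..} (Psi_star p \<alpha> \<beta> B1)"
    unfolding star_eq using pos by (intro log_concave_on_cmult log_concave_egf) simp
  moreover have "Psi_star p \<alpha> \<beta> B1 z1 * Psi_star p \<alpha> \<beta> B1 z2
      \<le> (Psi_star p \<alpha> \<beta> B1 ((z1 + z2) / 2))\<^sup>2" if "0 < z1" "0 < z2" for z1 z2
    using log_concave_on_midpoint[OF conc] that by simp
  moreover have "Psi_star p \<alpha> \<beta> B1 z \<le> exp (growth * z)" if "0 < z" for z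
    using egf_le_exp[OF that] pos[of 0] by (simp add: star_eq field_simps)
  moreover have "Psi_plus p \<alpha> \<beta> B1 z \<le> growth * Psi p \<alpha> \<beta> B1 z" if "0 < z" for z
    using egf_shift_le[OF that] by (simp add: Psi_eq_egf Psi_plus_eq_egf)
  ultimately show ?thesis
    unfolding growth_eq by blast
qed

end
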